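(* Suppose the coefficient assumptions stated in the context hold. Let $\bar\xi_1>\alpha_0$ be the unique solution $z\in(\alpha_0,\infty)$ of $\varepsilon_1(z)=1$, where $\varepsilon_1(z)=2\alpha_0^2P\,\widetilde\chi_1(z,\alpha_0)+\widetilde\Phi_1(z,\alpha_0)$. Then for each $\xi$ with $\alpha_0<\xi<\bar\xi_1$ there exists a unique solution $u_1\in C^0[\alpha_0,\xi]$ to the integral equation $$u_1(\eta)=\alpha_0^2P\big(\chi_1(\xi,u_1,\alpha_0)-\chi_1(\eta,u_1,\alpha_0)\big)+\Phi_1(\xi,u_1,\alpha_0)-\Phi_1(\eta,u_1,\alpha_0),\qquad \alpha_0\le\eta\le\xi.$$
   Context: Constants: $a,P,\lambda_b,L_b,\gamma_b>0$, $\theta_{ion}>\theta_b$, $k\in\mathbb R$, with $P\ge 2a\sqrt{2\pi}\sqrt{\lambda_bL_b\gamma_b(\theta_{ion}-\theta_b)}$ and $\alpha_0=\dfrac{2\sqrt\pi\lambda_b(\theta_{ion}-\theta_b)}{P-\sqrt{P^2-8a^2\pi L_b\gamma_b\lambda_b(\theta_{ion}-\theta_b)}}>0$. Coefficients: $L_i^*,N_i^*:\mathbb R\to\mathbb R$ and $K_i^*:\mathbb R\to[0,\infty)$, $i=1,2$. For $\xi>\alpha_0$, $\mathcal K=\mathcal K_\xi=\{u\in C^0[\xi,\infty): u(\xi)=0,\ \lim_{\eta\to\infty}u(\eta)=-1\}$. $\|\cdot\|$ is the supremum norm; $L_i^*(u)$ etc. denote compositions. Coefficient assumptions: there are positive constants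 $L_m,L_M,N_m,N_M,K_m,K_M,R,\widetilde L_i,\widetilde N_i,\widetilde K_i$ ($i=1,2$), independent of $\xi$, with $R\ge a^2N_M/L_m$, such that for every $\xi>\alpha_0$, all $u_1,u_1^*\in C^0[\alpha_0,\xi]$ and all $u_2,u_2^*\in\mathcal K_\xi$ (inequalities between functions are pointwise): for $i=1,2$, $L_m\le L_i^*(u_i)\le L_M$, $N_m\le N_i^*(u_i)\le N_M$, $\|L_i^*(u_i)-L_i^*(u_i^* )\|\le\widetilde L_i\|u_i-u_i^*\|$, $\|N_i^*(u_i)-N_i^*(u_i^* )\|\le\widetilde N_i\|u_i-u_i^*\|$; $K_m\le K_1^*(u_1)\le K_M$; $\|K_1^*(u_1)-K_1^*(u_1^* )\|\le\widetilde K_1\|u_1-u_1^*\|$; $K_2^*(u_2(s))\le K_Me^{-Rs^2}$ and $|K_2^*(u_2(s))-K_2^*(u_2^*(s))|\le\widetilde K_2e^{-Rs^2}\|u_2-u_2^*\|$ for $s\ge\xi$. Definitions, for $u_1\in C^0[\alpha_0,\xi]$ and $\alpha_0\le\eta\le\xi$: $E_1(\eta,u_1,\alpha_0)=\exp\big(-2a^2\int_{\alpha_0}^\eta v\frac{N_1^*(u_1(v))}{L_1^*(u_1(v))}dv\big)$, $\chi_1(\eta,u_1,\alpha_0)=\int_{\alpha_0}^\eta\frac{E_1(v,u_1,\alpha_0)}{v^2L_1^*(u_1(v))}dv$, $\Phi_1(\eta,u_1,\alpha_0)=\frac{k^2}{16a^2\pi^2}\int_{\alpha_0}^\eta\frac{E_1(v,u_1,\alpha_0)}{v^2L_1^*(u_1(v))}\int_{\alpha_0}^v\frac{K_1^*(u_1(s))}{s^2E_1(s,u_1,\alpha_0)}ds\,dv$.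 For $\eta\ge\alpha_0$, with $D=\frac{\widetilde N_1}{L_m}+\frac{N_M\widetilde L_1}{L_m^2}$, $g(\eta)=\exp\big(a^2\frac{N_m}{L_M}(\eta^2-\alpha_0^2)\big)$ and $e(\eta)=\exp\big(a^2\frac{N_M}{L_m}(\eta^2-\alpha_0^2)\big)$: $\widetilde\chi_1(\eta,\alpha_0)=\frac{a^2}{L_m}D\big(\eta+\frac{\alpha_0^2}{\eta}-2\alpha_0\big)+\frac{\widetilde L_1}{L_m^2}\big(\frac1{\alpha_0}-\frac1\eta\big)$, $\widetilde\Phi_1(\eta,\alpha_0)=\frac{k^2}{16a^2\pi^2}\Big\{\frac{K_M}{L_m}a^2D\,g(\eta)\big[\ln\frac{\alpha_0}{\eta}+\frac{\eta}{\alpha_0}+\frac{\alpha_0}{\eta}-\frac{\alpha_0^2}{2\eta^2}-\frac32\big]+\big(\frac{K_M\widetilde L_1}{L_m^2}+\frac{\widetilde K_1}{L_m}\big)e(\eta)\big[\frac1{2\alpha_0^2}+\frac1{2\eta^2}-\frac1{\alpha_0\eta}\big]+\frac{K_M}{L_m}a^2D\,e(\eta)^2\big[\ln\frac{\eta}{\alpha_0}-\frac{\alpha_0^2}{2\eta^2}-\frac32+\frac{2\alpha_0}{\eta}\big]\Big\}$. *)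

theory Defs
  imports "HOL-Analysis.Analysis" "HOL-Library.FuncSet"
begin

text \<open>
  Functions on a set \<open>S\<close> are represented as elements of \<^term>\<open>extensional S\<close>, so that equality in
  \<open>C0 S\<close> is equality on \<open>S\<close>.
\<close>

definition C0 :: "real set \<Rightarrow> (real \<Rightarrow> real) set" where
  "C0 S = {u. u \<in> extensional S \<and> continuous_on S u}"

definition K_space :: "real \<Rightarrow> (real \<Rightarrow> real) set" where
  "K_space \<xi> = {u \<in> C0 {\<xi>..}. u \<xi> = 0 \<and> (u \<longlongrightarrow> -1) at_top}"

text \<open>
  A supremum in the reals, hence meaningful only when \<open>f\<close> is bounded on the nonempty set \<open>S\<close>.
  It is only applied to differences of functions that are bounded there: continuous functions on
  a compact interval, elements of \<open>K_space \<xi>\<close>, and compositions with coefficients that are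
  assumed bounded.
\<close>

definition supnorm :: "real set \<Rightarrow> (real \<Rightarrow> real) \<Rightarrow> real" where
  "supnorm S f = (SUP s\<in>S. \<bar>f s\<bar>)"

definition bounded_on_class ::
    "(real \<Rightarrow> real) set \<Rightarrow> real set \<Rightarrow> (real \<Rightarrow> real) \<Rightarrow> real \<Rightarrow> real \<Rightarrow> bool" where
  "bounded_on_class X S F m M \<longleftrightarrow> (\<forall>u\<in>X. \<forall>s\<in>S. m \<le> F (u s) \<and> F (u s) \<le> M)"

definition lipschitz_on_class ::
    "(real \<Rightarrow> real) set \<Rightarrow> real set \<Rightarrow> (real \<Rightarrow> real) \<Rightarrow> real \<Rightarrow> bool" where
  "lipschitz_on_class X S F c \<longleftrightarrow>
     (\<forall>u\<in>X. \<forall>v\<in>X. supnorm S (\<lambda>s. F (u s) - F (v s)) \<le> c * supnorm S (\<lambda>s. u s - v s))"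

definition E1 ::
    "real \<Rightarrow> (real \<Rightarrow> real) \<Rightarrow> (real \<Rightarrow> real) \<Rightarrow> real \<Rightarrow> (real \<Rightarrow> real) \<Rightarrow> real \<Rightarrow> real" where
  "E1 a L1 N1 \<eta> u \<alpha>\<^sub>0 = exp (- 2 * a\<^sup>2 * integral {\<alpha>\<^sub>0..\<eta>} (\<lambda>v. v * (N1 (u v) / L1 (u v))))"

definition chi1 ::
    "real \<Rightarrow> (real \<Rightarrow> real) \<Rightarrow> (real \<Rightarrow> real) \<Rightarrow> real \<Rightarrow> (real \<Rightarrow> real) \<Rightarrow> real \<Rightarrow> real" where
  "chi1 a L1 N1 \<eta> u \<alpha>\<^sub>0 =
     integral {\<alpha>\<^sub>0..\<eta>} (\<lambda>v. E1 a L1 N1 v u \<alpha>\<^sub>0 / (v\<^sup>2 * L1 (u v)))"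

definition Phi1 ::
    "real \<Rightarrow> real \<Rightarrow> (real \<Rightarrow> real) \<Rightarrow> (real \<Rightarrow> real) \<Rightarrow> (real \<Rightarrow> real) \<Rightarrow>
     real \<Rightarrow> (real \<Rightarrow> real) \<Rightarrow> real \<Rightarrow> real" where
  "Phi1 a k L1 N1 K1 \<eta> u \<alpha>\<^sub>0 =
     k\<^sup>2 / (16 * a\<^sup>2 * pi\<^sup>2) *
     integral {\<alpha>\<^sub>0..\<eta>} (\<lambda>v. E1 a L1 N1 v u \<alpha>\<^sub>0 / (v\<^sup>2 * L1 (u v)) *
       integral {\<alpha>\<^sub>0..v} (\<lambda>s. K1 (u s) / (s\<^sup>2 * E1 a L1 N1 s u \<alpha>\<^sub>0)))"

text \<open>
  In the following, \<open>Lt\<close>, \<open>Nt\<close>, \<open>Kt\<close> are the Lipschitz constants (written with a tilde in the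
  mathematics) of the first coefficients.
\<close>

definition D_const :: "real \<Rightarrow> real \<Rightarrow> real \<Rightarrow> real \<Rightarrow> real" where
  "D_const L_m N_M Lt Nt = Nt / L_m + N_M * Lt / L_m\<^sup>2"

definition chi1_tilde ::
    "real \<Rightarrow> real \<Rightarrow> real \<Rightarrow> real \<Rightarrow> real \<Rightarrow> real \<Rightarrow> real \<Rightarrow> real" where
  "chi1_tilde a L_m N_M Lt Nt \<eta> \<alpha>\<^sub>0 =
     a\<^sup>2 / L_m * D_const L_m N_M Lt Nt * (\<eta> + \<alpha>\<^sub>0\<^sup>2 / \<eta> - 2 * \<alpha>\<^sub>0)
     + Lt / L_m\<^sup>2 * (1 / \<alpha>\<^sub>0 - 1 / \<eta>)"

definition Phi1_tilde ::
    "real \<Rightarrow> real \<Rightarrow> real \<Rightarrow> real \<Rightarrow> real \<Rightarrow> real \<Rightarrow> real \<Rightarrow> real \<Rightarrow> real \<Rightarrow> real \<Rightarrow>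
     real \<Rightarrow> real \<Rightarrow> real" where
  "Phi1_tilde a k L_m L_M N_m N_M K_M Lt Nt Kt \<eta> \<alpha>\<^sub>0 =
    (let D = D_const L_m N_M Lt Nt;
         g = exp (a\<^sup>2 * (N_m / L_M) * (\<eta>\<^sup>2 - \<alpha>\<^sub>0\<^sup>2));
         e = exp (a\<^sup>2 * (N_M / L_m) * (\<eta>\<^sup>2 - \<alpha>\<^sub>0\<^sup>2))
     in k\<^sup>2 / (16 * a\<^sup>2 * pi\<^sup>2) *
       (K_M / L_m * a\<^sup>2 * D * g *
          (ln (\<alpha>\<^sub>0 / \<eta>) + \<eta> / \<alpha>\<^sub>0 + \<alpha>\<^sub>0 / \<eta> - \<alpha>\<^sub>0\<^sup>2 / (2 * \<eta>\<^sup>2) - 3 / 2)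
        + (K_M * Lt / L_m\<^sup>2 + Kt / L_m) * e *
          (1 / (2 * \<alpha>\<^sub>0\<^sup>2) + 1 / (2 * \<eta>\<^sup>2) - 1 / (\<alpha>\<^sub>0 * \<eta>))
        + K_M / L_m * a\<^sup>2 * D * e\<^sup>2 *
          (ln (\<eta> / \<alpha>\<^sub>0) - \<alpha>\<^sub>0\<^sup>2 / (2 * \<eta>\<^sup>2) - 3 / 2 + 2 * \<alpha>\<^sub>0 / \<eta>)))"

definition eps1 ::
    "real \<Rightarrow> real \<Rightarrow> real \<Rightarrow> real \<Rightarrow> real \<Rightarrow> real \<Rightarrow> real \<Rightarrow> real \<Rightarrow> real \<Rightarrow> real \<Rightarrow> real \<Rightarrow>
     real \<Rightarrow> real \<Rightarrow> real" where
  "eps1 a k P L_m L_M N_m N_M K_M Lt Nt Kt \<alpha>\<^sub>0 z =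
     2 * \<alpha>\<^sub>0\<^sup>2 * P * chi1_tilde a L_m N_M Lt Nt z \<alpha>\<^sub>0
     + Phi1_tilde a k L_m L_M N_m N_M K_M Lt Nt Kt z \<alpha>\<^sub>0"

end

theory Submission
  imports Defs
begin

text \<open>
  The right-hand side of the integral equation is \<open>\<integral> F[u](v) dv\<close> over \<open>[\<eta>, \<xi>]\<close>. In the
  \<open>\<Phi>\<close>-part of \<open>F[u](v)\<close>, the factor \<open>E(v)\<close> is moved into the inner integral, where it
  meets \<open>1 / E(s)\<close>. The quotient \<open>E(v) / E(s) = exp (-2 a\<^sup>2 \<integral> t N/L dt)\<close>, integrated over
  \<open>[s, v]\<close>, is at most \<open>1\<close> and depends on \<open>u\<close> with Lipschitz constant \<open>a\<^sup>2 D (v\<^sup>2 - s\<^sup>2)\<close>.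
  This bounds \<open>F[u](v) - F[w](v)\<close> pointwise by an explicit function of \<open>v\<close>, whose
  antiderivative vanishing at \<open>\<alpha>\<^sub>0\<close> is at most \<open>\<epsilon>\<^sub>1\<close>, so the right-hand side is a
  contraction as long as \<open>\<epsilon>\<^sub>1(\<xi>) < 1\<close>. Moreover \<open>\<epsilon>\<^sub>1\<close> is strictly increasing from \<open>0\<close> to
  \<open>\<infinity>\<close>, because every bracket in it vanishes at \<open>\<alpha>\<^sub>0\<close> and has a nonnegative derivative.
\<close>

section \<open>Elementary estimates for differences of quotients, products and exponentials\<close>

text \<open>Going through \<open>y / p\<close> changes one variable at a time. This serves every
  quotient with denominator \<open>L\<close>, with \<open>m\<close> the lower bound
  \<open>L_m\<close>.\<close>

lemma abs_diff_quotient_le: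
  fixes x y p q :: real
  assumes "m > 0" "p \<ge> m" "q \<ge> m" "\<bar>y\<bar> \<le> Y"
  shows "\<bar>x / p - y / q\<bar> \<le> \<bar>x - y\<bar> / m + Y * \<bar>p - q\<bar> / m\<^sup>2"
proof -
  have "x / p - y / q = (x - y) / p + y * (q - p) / (p * q)"
    using assms by (simp add: field_simps)
  then have "\<bar>x / p - y / q\<bar> \<le> \<bar>x - y\<bar> / p + \<bar>y\<bar> * \<bar>p - q\<bar> / (p * q)"
    using assms abs_triangle_ineq[of "(x - y) / p" "y * (q - p) / (p * q)"]
    by (simp add: abs_mult abs_minus_commute)
  moreover have "\<bar>x - y\<bar> / p \<le> \<bar>x - y\<bar> / m"
    using assms by (intro divide_left_mono) auto
  moreover have "\<bar>y\<bar> * \<bar>p - q\<bar> / (p * q) \<le> Y * \<bar>p - q\<bar> / m\<^sup>2"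
    using assms by (intro frac_le mult_right_mono) (auto simp: power2_eq_square intro: mult_mono)
  ultimately show ?thesis by linarith
qed

lemma abs_diff_mult_le:
  fixes x y p q :: real
  assumes "\<bar>x\<bar> \<le> X" "\<bar>q\<bar> \<le> Q"
  shows "\<bar>x * p - y * q\<bar> \<le> X * \<bar>p - q\<bar> + Q * \<bar>x - y\<bar>"
proof -
  have "\<bar>x * p - y * q\<bar> = \<bar>x * (p - q) + q * (x - y)\<bar>" by (simp add: algebra_simps)
  also have "\<dots> \<le> \<bar>x\<bar> * \<bar>p - q\<bar> + \<bar>q\<bar> * \<bar>x - y\<bar>"
    by (metis abs_mult abs_triangle_ineq)
  also have "\<dots> \<le> X * \<bar>p - q\<bar> + Q * \<bar>x - y\<bar>"
    using assms by (intro add_mono mult_right_mono) auto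
  finally show ?thesis .
qed

text \<open>The factor \<open>exp (- s)\<close> is at most 1 for \<open>s \<ge> 0\<close>, and what
  it leaves, \<open>1 - exp (- h)\<close> with \<open>h = t - s\<close>, is at most
  \<open>h\<close>.\<close>

lemma abs_diff_exp_neg_le:
  fixes x y :: real
  assumes "x \<ge> 0" "y \<ge> 0"
  shows "\<bar>exp (- x) - exp (- y)\<bar> \<le> \<bar>x - y\<bar>"
proof -
  have *: "exp (- s) - exp (- t) \<le> t - s" if "0 \<le> s" "s \<le> t" for s t :: real
  proof -
    have "exp (- s) - exp (- t) = exp (- s) * (1 - exp (- (t - s)))"
      by (simp add: algebra_simps flip: exp_add)
    also have "\<dots> \<le> 1 * (t - s)"
      using that exp_ge_add_one_self[of "s - t"] by (intro mult_mono) (simp_all add: algebra_simps)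
    finally show ?thesis by simp
  qed
  show ?thesis
    using *[of x y] *[of y x] assms by (cases "x \<le> y") auto
qed

section \<open>From conditions on compositions to conditions on the coefficients\<close>

lemma C0_const: "(\<lambda>s\<in>S. c) \<in> C0 S"
  unfolding C0_def using continuous_on_cong[of S S "\<lambda>s\<in>S. c" "\<lambda>s. c"] by auto

text \<open>Constant functions are admissible, so the conditions on compositions are
  conditions on the coefficient itself.\<close>

lemma bounded_on_class_C0D:
  assumes "bounded_on_class (C0 S) S F m M" "S \<noteq> {}"
  shows "m \<le> F x" "F x \<le> M"
proof -
  obtain s where "s \<in> S" using assms by blast
  then show "m \<le> F x" "F x \<le> M"
    using assms(1) C0_const[where S = S and c = x] unfolding bounded_on_class_def by force+
qed

lemma lipschitz_on_class_C0D:
  assumes "lipschitz_on_class (C0 S) S F c" "S \<noteq> {}"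
  shows "\<bar>F x - F y\<bar> \<le> c * \<bar>x - y\<bar>"
proof -
  have "supnorm S (\<lambda>s. F ((\<lambda>s\<in>S. x) s) - F ((\<lambda>s\<in>S. y) s))
      \<le> c * supnorm S (\<lambda>s. (\<lambda>s\<in>S. x) s - (\<lambda>s\<in>S. y) s)"
    using assms(1) C0_const[where S = S] unfolding lipschitz_on_class_def by blast
  also have "supnorm S (\<lambda>s. F ((\<lambda>s\<in>S. x) s) - F ((\<lambda>s\<in>S. y) s)) = \<bar>F x - F y\<bar>"
    using assms(2) unfolding supnorm_def by (simp cong: image_cong)
  also have "supnorm S (\<lambda>s. (\<lambda>s\<in>S. x) s - (\<lambda>s\<in>S. y) s) = \<bar>x - y\<bar>"
    using assms(2) unfolding supnorm_def by (simp cong: image_cong)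
  finally show ?thesis .
qed

lemma continuous_on_UNIV_if_abs_le:
  fixes F :: "real \<Rightarrow> real"
  assumes "\<And>x y. \<bar>F x - F y\<bar> \<le> c * \<bar>x - y\<bar>"
  shows "continuous_on UNIV F"
proof -
  \<comment> \<open>\<open>c\<close> may have any sign here, while \<open>lipschitz_on\<close> asks
    for a nonnegative constant.\<close>
  have "(\<bar>c\<bar>)-lipschitz_on UNIV F"
  proof (rule lipschitz_onI)
    show "dist (F x) (F y) \<le> \<bar>c\<bar> * dist x y" for x y
      using assms[of x y] mult_right_mono[of c "\<bar>c\<bar>" "\<bar>x - y\<bar>"]
      unfolding dist_real_def by linarith
  qed simp
  then show ?thesis by (rule lipschitz_on_continuous_on)
qed

lemma integral_diff_lower:
  fixes f :: "real \<Rightarrow> real"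
  assumes "f integrable_on {a..c}" "a \<le> b" "b \<le> c"
  shows "integral {a..c} f - integral {a..b} f = integral {b..c} f"
  using Henstock_Kurzweil_Integration.integral_combine[OF assms(2,3,1)] by simp

section \<open>Banach's fixed point theorem on a compact interval\<close>

text \<open>Existence comes from the complete space of bounded continuous functions on the whole
  line: \<open>T f\<close> is extended beyond the interval by its endpoint values, which keeps it
  continuous and preserves the contraction. Uniqueness is shown directly on the interval. A
  pointwise bound \<open>M\<close> takes the place of the supremum norm.\<close>

lemma unique_fixed_point_on_interval:
  fixes T :: "(real \<Rightarrow> real) \<Rightarrow> real \<Rightarrow> real"
  assumes "\<alpha> \<le> \<xi>" "0 \<le> c" "c < 1"
    and cont: "\<And>u. continuous_on {\<alpha>..\<xi>} u \<Longrightarrow> continuous_on {\<alpha>..\<xi>} (T u)"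
    and contraction: "\<And>u w M \<eta>. \<lbrakk>continuous_on {\<alpha>..\<xi>} u; continuous_on {\<alpha>..\<xi>} w;
      \<And>t. t \<in> {\<alpha>..\<xi>} \<Longrightarrow> \<bar>u t - w t\<bar> \<le> M; \<eta> \<in> {\<alpha>..\<xi>}\<rbrakk> \<Longrightarrow> \<bar>T u \<eta> - T w \<eta>\<bar> \<le> c * M"
  shows "\<exists>!u. u \<in> C0 {\<alpha>..\<xi>} \<and> (\<forall>\<eta>\<in>{\<alpha>..\<xi>}. u \<eta> = T u \<eta>)"
proof -
  define F :: "(real \<Rightarrow>\<^sub>C real) \<Rightarrow> (real \<Rightarrow>\<^sub>C real)" where
    "F f = Bcontfun (ext_cont (T f) \<alpha> \<xi>)" for f
  have cont': "continuous_on (cbox \<alpha> \<xi>) (T (apply_bcontfun f))" for f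
    using cont[of "apply_bcontfun f"] by simp
  have "ext_cont (T (apply_bcontfun f)) \<alpha> \<xi> \<in> bcontfun" for f
    unfolding bcontfun_def ext_cont_def
    using clamp_continuous_on[OF cont'] compact_continuous_image[OF cont' compact_cbox]
    by (intro CollectI conjI clamp_bounded compact_imp_bounded)
  then have F: "apply_bcontfun (F f) = ext_cont (T (apply_bcontfun f)) \<alpha> \<xi>" for f
    unfolding F_def by (simp add: Bcontfun_inverse)
  have "dist (F f) (F g) \<le> c * dist f g" for f g
  proof (rule dist_bound)
    fix x
    have "clamp \<alpha> \<xi> x \<in> {\<alpha>..\<xi>}"
      using clamp_in_interval[of \<alpha> \<xi> x] assms(1) by simp
    then show "dist (F f x) (F g x) \<le> c * dist f g"
      using dist_bounded[of f _ g]
      by (auto simp: F ext_cont_def dist_real_def intro!: contraction)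
  qed
  then obtain f where f: "F f = f"
    using banach_fix_type[of c F] assms(2,3) by blast
  let ?u = "restrict (apply_bcontfun f) {\<alpha>..\<xi>}"
  have u_cont: "continuous_on {\<alpha>..\<xi>} ?u"
    using continuous_on_cong[of "{\<alpha>..\<xi>}" "{\<alpha>..\<xi>}" ?u "apply_bcontfun f"] by simp
  have "?u \<eta> = T ?u \<eta>" if \<eta>: "\<eta> \<in> {\<alpha>..\<xi>}" for \<eta>
  proof -
    have "?u \<eta> = T f \<eta>"
      using F[of f] \<eta> ext_cont_cancel_cbox[of \<eta> \<alpha> \<xi> "T f"] unfolding f by simp
    \<comment> \<open>Contraction with \<open>M = 0\<close> shows that \<open>T\<close> sees only
      the values on the interval, so restricting \<open>f\<close> does not change \<open>T f\<close>
      there.\<close>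
    moreover have "\<bar>T ?u \<eta> - T f \<eta>\<bar> \<le> c * 0"
      using \<eta> by (intro contraction u_cont) auto
    ultimately show ?thesis by simp
  qed
  then have "?u \<in> C0 {\<alpha>..\<xi>} \<and> (\<forall>\<eta>\<in>{\<alpha>..\<xi>}. ?u \<eta> = T ?u \<eta>)"
    using u_cont unfolding C0_def by blast
  moreover have "u = w"
    if u: "u \<in> C0 {\<alpha>..\<xi>} \<and> (\<forall>\<eta>\<in>{\<alpha>..\<xi>}. u \<eta> = T u \<eta>)"
      and w: "w \<in> C0 {\<alpha>..\<xi>} \<and> (\<forall>\<eta>\<in>{\<alpha>..\<xi>}. w \<eta> = T w \<eta>)" for u w
  proof -
    have cont_uw: "continuous_on {\<alpha>..\<xi>} u" "continuous_on {\<alpha>..\<xi>} w"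
      using u w by (auto simp: C0_def)
    have "continuous_on {\<alpha>..\<xi>} (\<lambda>t. \<bar>u t - w t\<bar>)"
      by (intro continuous_intros cont_uw)
    \<comment> \<open>Where the distance of the two solutions is largest, contraction bounds it by
      \<open>c\<close> times itself, so it is 0.\<close>
    then obtain m where m: "m \<in> {\<alpha>..\<xi>}" "\<And>t. t \<in> {\<alpha>..\<xi>} \<Longrightarrow> \<bar>u t - w t\<bar> \<le> \<bar>u m - w m\<bar>"
      using continuous_attains_sup[of "{\<alpha>..\<xi>}" "\<lambda>t. \<bar>u t - w t\<bar>"] assms(1) by auto
    then have "\<bar>T u m - T w m\<bar> \<le> c * \<bar>u m - w m\<bar>"
      using cont_uw by (intro contraction)
    then have "(1 - c) * \<bar>u m - w m\<bar> \<le> 0"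
      using u w m(1) by (simp add: algebra_simps)
    then have "\<bar>u m - w m\<bar> = 0"
      using assms(3) by (simp add: mult_le_0_iff)
    then show "u = w"
      using u w m(2) unfolding C0_def by (intro extensionalityI[of u "{\<alpha>..\<xi>}" w]) fastforce+
  qed
  ultimately show ?thesis by blast
qed

section \<open>The three brackets of \<open>Phi1_tilde\<close>\<close>

text \<open>For \<open>z \<ge> \<alpha>\<close> the brackets are the double integrals of
  \<open>(v\<^sup>2 - \<alpha>\<^sup>2) / (v\<^sup>2 * s\<^sup>2)\<close>,
  \<open>1 / (v\<^sup>2 * s\<^sup>2)\<close> and
  \<open>(s\<^sup>2 - \<alpha>\<^sup>2) / (v\<^sup>2 * s\<^sup>2)\<close> over \<alpha> \<le> s
  \<le> v \<le> z. Hence the first minus the third has the numerator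
  \<open>v\<^sup>2 - s\<^sup>2\<close>.\<close>

definition Phi_bracket1 :: "real \<Rightarrow> real \<Rightarrow> real" where
  "Phi_bracket1 \<alpha> z = ln (\<alpha> / z) + z / \<alpha> + \<alpha> / z - \<alpha>\<^sup>2 / (2 * z\<^sup>2) - 3 / 2"

definition Phi_bracket2 :: "real \<Rightarrow> real \<Rightarrow> real" where
  "Phi_bracket2 \<alpha> z = 1 / (2 * \<alpha>\<^sup>2) + 1 / (2 * z\<^sup>2) - 1 / (\<alpha> * z)"

definition Phi_bracket3 :: "real \<Rightarrow> real \<Rightarrow> real" where
  "Phi_bracket3 \<alpha> z = ln (z / \<alpha>) - \<alpha>\<^sup>2 / (2 * z\<^sup>2) - 3 / 2 + 2 * \<alpha> / z"

text \<open>The derivatives are factored so that their signs on [\<alpha>, \<infinity>) can be read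
  off.\<close>

lemma Phi_bracket_deriv:
  fixes \<alpha> z :: real
  assumes "\<alpha> > 0" "z > 0"
  shows "(Phi_bracket1 \<alpha> has_real_derivative (1 - \<alpha> / z)\<^sup>2 * (1 + \<alpha> / z) / \<alpha>) (at z within S)"
    and "(Phi_bracket2 \<alpha> has_real_derivative (1 / \<alpha> - 1 / z) / z\<^sup>2) (at z within S)"
    and "(Phi_bracket3 \<alpha> has_real_derivative (1 - \<alpha> / z)\<^sup>2 / z) (at z within S)"
  unfolding Phi_bracket1_def Phi_bracket2_def Phi_bracket3_def using assms
  by (auto intro!: derivative_eq_intros simp: field_simps power2_eq_square)

lemma Phi_bracket_self:
  assumes "\<alpha> \<noteq> 0"
  shows "Phi_bracket1 \<alpha> \<alpha> = 0" "Phi_bracket2 \<alpha> \<alpha> = 0" "Phi_bracket3 \<alpha> \<alpha> = 0"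
  unfolding Phi_bracket1_def Phi_bracket2_def Phi_bracket3_def using assms
  by (auto simp: field_simps power2_eq_square)

lemma Phi_bracket_mono:
  assumes "0 < \<alpha>" "\<alpha> \<le> y" "y \<le> z"
  shows "Phi_bracket1 \<alpha> y \<le> Phi_bracket1 \<alpha> z" "Phi_bracket2 \<alpha> y \<le> Phi_bracket2 \<alpha> z"
    "Phi_bracket3 \<alpha> y \<le> Phi_bracket3 \<alpha> z"
proof -
  have *: "f y \<le> f z" if "\<And>x. \<lbrakk>0 < x; \<alpha> \<le> x\<rbrakk> \<Longrightarrow> (f has_real_derivative f' x) (at x)"
    "\<And>x. \<lbrakk>0 < x; \<alpha> \<le> x\<rbrakk> \<Longrightarrow> f' x \<ge> 0" for f f' :: "real \<Rightarrow> real"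
  proof (rule DERIV_nonneg_imp_nondecreasing[OF assms(3)])
    fix x assume "y \<le> x" "x \<le> z"
    then have "0 < x" "\<alpha> \<le> x" using assms by auto
    then show "\<exists>d. (f has_real_derivative d) (at x) \<and> d \<ge> 0" using that by blast
  qed
  show "Phi_bracket1 \<alpha> y \<le> Phi_bracket1 \<alpha> z" "Phi_bracket2 \<alpha> y \<le> Phi_bracket2 \<alpha> z"
    "Phi_bracket3 \<alpha> y \<le> Phi_bracket3 \<alpha> z"
    using assms(1) by (rule *[OF Phi_bracket_deriv(1)] *[OF Phi_bracket_deriv(2)]
        *[OF Phi_bracket_deriv(3)]; force simp: frac_le)+
qed

lemma Phi_bracket_nonneg:
  assumes "0 < \<alpha>" "\<alpha> \<le> z"
  shows "Phi_bracket1 \<alpha> z \<ge> 0" "Phi_bracket2 \<alpha> z \<ge> 0" "Phi_bracket3 \<alpha> z \<ge> 0"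
  using Phi_bracket_mono[of \<alpha> \<alpha> z] Phi_bracket_self[of \<alpha>] assms by auto

lemma Phi1_tilde_eq_brackets:
  "Phi1_tilde a k L_m L_M N_m N_M K_M Lt Nt Kt z \<alpha> = k\<^sup>2 / (16 * a\<^sup>2 * pi\<^sup>2) *
    (K_M / L_m * a\<^sup>2 * D_const L_m N_M Lt Nt * exp (a\<^sup>2 * (N_m / L_M) * (z\<^sup>2 - \<alpha>\<^sup>2)) * Phi_bracket1 \<alpha> z
     + (K_M * Lt / L_m\<^sup>2 + Kt / L_m) * exp (a\<^sup>2 * (N_M / L_m) * (z\<^sup>2 - \<alpha>\<^sup>2)) * Phi_bracket2 \<alpha> z
     + K_M / L_m * a\<^sup>2 * D_const L_m N_M Lt Nt * (exp (a\<^sup>2 * (N_M / L_m) * (z\<^sup>2 - \<alpha>\<^sup>2)))\<^sup>2 * Phi_bracket3 \<alpha> z)"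
  unfolding Phi1_tilde_def Phi_bracket1_def Phi_bracket2_def Phi_bracket3_def Let_def ..

section \<open>Continuity of the integrands and bounds for quotients of \<open>E\<close>\<close>

text \<open>The pointwise form of the conditions on the first coefficients, with
  \<open>\<alpha>\<close> in the role of \<open>\<alpha>\<^sub>0\<close>. \<open>L_M\<close> and
  \<open>N_m\<close> enter \<open>Phi1_tilde\<close> through an exponent and are passed to the
  lemmas that mention them.\<close>

locale coefficients =
  fixes a k \<alpha> L_m N_M K_M Lt Nt Kt :: real and L N K :: "real \<Rightarrow> real"
  assumes a_pos: "a > 0" and \<alpha>_pos: "\<alpha> > 0" and L_m_pos: "L_m > 0"
    and L_lower: "\<And>x. L_m \<le> L x"
    and N_bounds: "\<And>x. 0 \<le> N x" "\<And>x. N x \<le> N_M"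
    and K_bounds: "\<And>x. 0 \<le> K x" "\<And>x. K x \<le> K_M"
    and L_lipschitz: "\<And>x y. \<bar>L x - L y\<bar> \<le> Lt * \<bar>x - y\<bar>"
    and N_lipschitz: "\<And>x y. \<bar>N x - N y\<bar> \<le> Nt * \<bar>x - y\<bar>"
    and K_lipschitz: "\<And>x y. \<bar>K x - K y\<bar> \<le> Kt * \<bar>x - y\<bar>"
    and Lt_pos: "Lt > 0" and Nt_pos: "Nt > 0" and Kt_pos: "Kt > 0"
begin

lemma L_pos: "L x > 0"
  using L_lower[of x] L_m_pos by linarith

lemma N_M_nonneg: "N_M \<ge> 0" and K_M_nonneg: "K_M \<ge> 0"
  using N_bounds[of 0] K_bounds[of 0] by auto

abbreviation "D \<equiv> D_const L_m N_M Lt Nt"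
abbreviation "E v u \<equiv> E1 a L N v u \<alpha>"

lemma D_pos: "D > 0"
  unfolding D_const_def
  using L_m_pos N_M_nonneg Lt_pos Nt_pos by (intro add_pos_nonneg) auto

definition chi_density :: "(real \<Rightarrow> real) \<Rightarrow> real \<Rightarrow> real" where
  "chi_density u v = E v u / (v\<^sup>2 * L (u v))"

definition inner_integral :: "(real \<Rightarrow> real) \<Rightarrow> real \<Rightarrow> real" where
  "inner_integral u v = integral {\<alpha>..v} (\<lambda>s. K (u s) / (s\<^sup>2 * E s u))"

lemma E_pos: "E v u > 0"
  by (simp add: E1_def)

context
  fixes u :: "real \<Rightarrow> real" and \<xi> :: real
  assumes u_cont: "continuous_on {\<alpha>..\<xi>} u"
begin

lemma continuous_on_coefficients:
  "continuous_on {\<alpha>..\<xi>} (\<lambda>v. L (u v))"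
  "continuous_on {\<alpha>..\<xi>} (\<lambda>v. N (u v))"
  "continuous_on {\<alpha>..\<xi>} (\<lambda>v. K (u v))"
  using u_cont continuous_on_UNIV_if_abs_le[OF L_lipschitz]
    continuous_on_UNIV_if_abs_le[OF N_lipschitz] continuous_on_UNIV_if_abs_le[OF K_lipschitz]
  by (auto intro: continuous_on_compose2)

lemma rate_continuous: "continuous_on {\<alpha>..\<xi>} (\<lambda>v. v * (N (u v) / L (u v)))"
  using L_pos by (intro continuous_intros continuous_on_coefficients) (metis less_irrefl)

lemma E_continuous: "continuous_on {\<alpha>..\<xi>} (\<lambda>v. E v u)"
  unfolding E1_def
  by (intro continuous_intros indefinite_integral_continuous_1 integrable_continuous_real
      rate_continuous)

lemma chi_density_continuous: "continuous_on {\<alpha>..\<xi>} (chi_density u)"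
  unfolding chi_density_def using L_pos \<alpha>_pos
  by (intro continuous_intros continuous_on_coefficients E_continuous)
    (auto simp: less_le)

lemma inner_integrand_continuous: "continuous_on {\<alpha>..\<xi>} (\<lambda>s. K (u s) / (s\<^sup>2 * E s u))"
  using E_pos \<alpha>_pos
  by (intro continuous_intros continuous_on_coefficients E_continuous)
    (auto simp: less_le)

lemma inner_integral_continuous: "continuous_on {\<alpha>..\<xi>} (inner_integral u)"
  unfolding inner_integral_def
  by (intro indefinite_integral_continuous_1 integrable_continuous_real
      inner_integrand_continuous)

lemma E_quotient:
  assumes "\<alpha> \<le> s" "s \<le> v" "v \<le> \<xi>"
  shows "E v u / E s u = exp (- (2 * a\<^sup>2 * integral {s..v} (\<lambda>v. v * (N (u v) / L (u v)))))"
proof -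
  have "integral {\<alpha>..v} (\<lambda>v. v * (N (u v) / L (u v))) - integral {\<alpha>..s} (\<lambda>v. v * (N (u v) / L (u v)))
      = integral {s..v} (\<lambda>v. v * (N (u v) / L (u v)))"
    using assms by (intro integral_diff_lower integrable_continuous_real
        continuous_on_subset[OF rate_continuous]) auto
  then show ?thesis
    unfolding E1_def exp_diff[symmetric] by (simp add: algebra_simps flip: right_diff_distrib)
qed

lemma rate_integral_nonneg:
  assumes "\<alpha> \<le> s"
  shows "integral {s..v} (\<lambda>v. v * (N (u v) / L (u v))) \<ge> 0"
\<comment> \<open>Since \<open>v\<close> may exceed \<open>\<xi>\<close>, where nothing is known
  about \<open>u\<close>, integrability can fail; the integral then has the default value 0.\<close>
proof (cases "(\<lambda>v. v * (N (u v) / L (u v))) integrable_on {s..v}")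
  case True
  then show ?thesis
    using assms \<alpha>_pos N_bounds L_pos by (intro integral_nonneg) (auto simp: less_imp_le)
qed (simp add: not_integrable_integral)

lemma E_quotient_le_1:
  assumes "\<alpha> \<le> s" "s \<le> v" "v \<le> \<xi>"
  shows "E v u / E s u \<le> 1"
  unfolding E_quotient[OF assms] using rate_integral_nonneg[OF assms(1)] by simp

lemma chi_density_mult_inner_integral:
  assumes "v \<le> \<xi>"
  shows "chi_density u v * inner_integral u v =
    integral {\<alpha>..v} (\<lambda>s. K (u s) * (E v u / E s u) / L (u v) / (v\<^sup>2 * s\<^sup>2))"
  unfolding chi_density_def inner_integral_def integral_mult_right[symmetric]
  by (simp add: field_simps)

lemma density_integrable:
  assumes "v \<le> \<xi>"
  shows "(\<lambda>s. K (u s) * (E v u / E s u) / L (u v) / (v\<^sup>2 * s\<^sup>2)) integrable_on {\<alpha>..v}"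
proof -
  have "(\<lambda>s. chi_density u v * (K (u s) / (s\<^sup>2 * E s u))) integrable_on {\<alpha>..v}"
    using assms by (intro integrable_on_mult_right integrable_continuous_real
        continuous_on_subset[OF inner_integrand_continuous]) auto
  then show ?thesis by (simp add: chi_density_def field_simps)
qed

end

section \<open>Pointwise Lipschitz bounds for the integrands\<close>

text \<open>The Lipschitz constant of \<open>chi_density\<close> at \<open>v\<close>, and also the
  derivative of \<open>chi1_tilde\<close>. The first summand accounts for the variation of
  \<open>E\<close>, the second for that of \<open>1 / L\<close>.\<close>

definition chi_majorant :: "real \<Rightarrow> real" where
  "chi_majorant v = a\<^sup>2 * D / L_m * (1 - \<alpha>\<^sup>2 / v\<^sup>2) + Lt / L_m\<^sup>2 / v\<^sup>2"

text \<open>With \<open>A\<close> and \<open>C\<close> for the two constant factors, this is the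
  integral of \<open>(A * (v\<^sup>2 - s\<^sup>2) + C) / (v\<^sup>2 * s\<^sup>2)\<close> over s in
  [\<alpha>, v].\<close>

definition Phi_majorant :: "real \<Rightarrow> real" where
  "Phi_majorant v = K_M / L_m * a\<^sup>2 * D * (1 / \<alpha> - 2 / v + \<alpha> / v\<^sup>2) +
     (K_M * Lt / L_m\<^sup>2 + Kt / L_m) * (1 / \<alpha> - 1 / v) / v\<^sup>2"

context
  fixes u w :: "real \<Rightarrow> real" and \<xi> M :: real
  assumes u_cont: "continuous_on {\<alpha>..\<xi>} u" and w_cont: "continuous_on {\<alpha>..\<xi>} w"
    and close: "\<And>t. t \<in> {\<alpha>..\<xi>} \<Longrightarrow> \<bar>u t - w t\<bar> \<le> M"
begin

lemma coefficients_close: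
  assumes "t \<in> {\<alpha>..\<xi>}"
  shows "\<bar>L (u t) - L (w t)\<bar> \<le> Lt * M" "\<bar>N (u t) - N (w t)\<bar> \<le> Nt * M"
    "\<bar>K (u t) - K (w t)\<bar> \<le> Kt * M"
  using L_lipschitz[of "u t" "w t"] N_lipschitz[of "u t" "w t"] K_lipschitz[of "u t" "w t"]
    mult_left_mono[OF close[OF assms]] Lt_pos Nt_pos Kt_pos
  by (meson less_imp_le order_trans)+

text \<open>This is where \<open>D\<close> arises: it is the Lipschitz constant that the quotient
  estimate gives for \<open>N / L\<close>.\<close>

lemma rate_close:
  assumes "t \<in> {\<alpha>..\<xi>}"
  shows "\<bar>N (u t) / L (u t) - N (w t) / L (w t)\<bar> \<le> D * M"
proof -
  have "\<bar>N (u t) / L (u t) - N (w t) / L (w t)\<bar>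
      \<le> \<bar>N (u t) - N (w t)\<bar> / L_m + N_M * \<bar>L (u t) - L (w t)\<bar> / L_m\<^sup>2"
    using L_m_pos L_lower N_bounds by (intro abs_diff_quotient_le) auto
  also have "\<dots> \<le> Nt * M / L_m + N_M * (Lt * M) / L_m\<^sup>2"
    using coefficients_close[OF assms] L_m_pos N_M_nonneg
    by (intro add_mono divide_right_mono mult_left_mono) auto
  also have "\<dots> = D * M" by (simp add: D_const_def algebra_simps add_divide_distrib)
  finally show ?thesis .
qed

text \<open>Both exponents are nonpositive, so the exponential costs nothing. The rates differ by at
  most \<open>t * D * M\<close>, and integrating \<open>t\<close> over [s, v] gives a factor 1/2
  that cancels the 2 in the exponent.\<close>

lemma E_quotient_close:
  assumes "\<alpha> \<le> s" "s \<le> v" "v \<le> \<xi>"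
  shows "\<bar>E v u / E s u - E v w / E s w\<bar> \<le> a\<^sup>2 * D * (v\<^sup>2 - s\<^sup>2) * M"
proof -
  let ?r = "\<lambda>u v. v * (N (u v) / L (u v))"
  have int: "?r u integrable_on {s..v}" "?r w integrable_on {s..v}"
    using assms
    by (intro integrable_continuous_real continuous_on_subset[OF rate_continuous[OF u_cont]]
        continuous_on_subset[OF rate_continuous[OF w_cont]]; auto)+
  have 1: "((\<lambda>t. t * (D * M)) has_integral (v\<^sup>2 / 2 * (D * M) - s\<^sup>2 / 2 * (D * M))) {s..v}"
    using assms(2) by (intro fundamental_theorem_of_calculus)
      (auto intro!: derivative_eq_intros simp flip: has_real_derivative_iff_has_vector_derivative)
  have "\<bar>integral {s..v} (?r u) - integral {s..v} (?r w)\<bar> = norm (integral {s..v} (\<lambda>t. ?r u t - ?r w t))"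
    using int by (simp add: integral_diff)
  also have "\<dots> \<le> integral {s..v} (\<lambda>t. t * (D * M))"
  proof (rule integral_norm_bound_integral)
    fix t assume t: "t \<in> {s..v}"
    have "\<bar>?r u t - ?r w t\<bar> = t * \<bar>N (u t) / L (u t) - N (w t) / L (w t)\<bar>"
      unfolding right_diff_distrib[symmetric] abs_mult using t assms \<alpha>_pos by simp
    also have "\<dots> \<le> t * (D * M)"
      using t assms \<alpha>_pos by (intro mult_left_mono rate_close) auto
    finally show "norm (?r u t - ?r w t) \<le> t * (D * M)" by simp
  qed (use int 1 in \<open>auto intro: integrable_diff\<close>)
  also have "\<dots> = D * (v\<^sup>2 - s\<^sup>2) * M / 2"
    using integral_unique[OF 1] by (simp add: field_simps)
  finally have 2: "\<bar>integral {s..v} (?r u) - integral {s..v} (?r w)\<bar> \<le> D * (v\<^sup>2 - s\<^sup>2) * M / 2" .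
  have "\<bar>E v u / E s u - E v w / E s w\<bar>
     \<le> \<bar>2 * a\<^sup>2 * integral {s..v} (?r u) - 2 * a\<^sup>2 * integral {s..v} (?r w)\<bar>"
    unfolding E_quotient[OF u_cont assms] E_quotient[OF w_cont assms]
    using rate_integral_nonneg[OF u_cont assms(1)] rate_integral_nonneg[OF w_cont assms(1)]
    by (intro abs_diff_exp_neg_le) auto
  also have "\<dots> = 2 * a\<^sup>2 * \<bar>integral {s..v} (?r u) - integral {s..v} (?r w)\<bar>"
    by (simp add: abs_mult flip: right_diff_distrib)
  also have "\<dots> \<le> 2 * a\<^sup>2 * (D * (v\<^sup>2 - s\<^sup>2) * M / 2)"
    by (intro mult_left_mono 2) auto
  finally show ?thesis by simp
qed

lemma chi_density_close:
  assumes "v \<in> {\<alpha>..\<xi>}"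
  shows "\<bar>chi_density u v - chi_density w v\<bar> \<le> chi_majorant v * M"
proof -
  have v: "v > 0" using assms \<alpha>_pos by auto
  \<comment> \<open>This makes \<open>E v u\<close> a quotient with \<open>s = \<alpha>\<close>, so
    the quotient bounds apply to it.\<close>
  have [simp]: "E \<alpha> u = 1" for u by (simp add: E1_def)
  have E: "\<bar>E v u - E v w\<bar> \<le> a\<^sup>2 * D * (v\<^sup>2 - \<alpha>\<^sup>2) * M"
    using E_quotient_close[of \<alpha> v] assms by simp
  have "\<bar>E v u / L (u v) - E v w / L (w v)\<bar>
      \<le> \<bar>E v u - E v w\<bar> / L_m + 1 * \<bar>L (u v) - L (w v)\<bar> / L_m\<^sup>2"
    using L_m_pos L_lower E_quotient_le_1[OF w_cont, of \<alpha> v] E_pos[of v w] assms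
    by (intro abs_diff_quotient_le) auto
  also have "\<dots> \<le> a\<^sup>2 * D * (v\<^sup>2 - \<alpha>\<^sup>2) * M / L_m + 1 * (Lt * M) / L_m\<^sup>2"
    using E coefficients_close(1)[OF assms] L_m_pos
    by (intro add_mono divide_right_mono mult_left_mono) auto
  also have "\<dots> = v\<^sup>2 * (chi_majorant v * M)"
    using v L_m_pos by (simp add: chi_majorant_def field_simps)
  finally have "\<bar>E v u / L (u v) - E v w / L (w v)\<bar> / v\<^sup>2 \<le> chi_majorant v * M"
    using v by (simp add: field_simps)
  moreover have "chi_density u v - chi_density w v = (E v u / L (u v) - E v w / L (w v)) / v\<^sup>2"
    using v by (simp add: chi_density_def diff_divide_distrib mult.commute)
  ultimately show ?thesis using v by simp
qed

text \<open>With the product written as a single integral over s, the integrand varies through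
  \<open>K (u s)\<close>, the quotient of \<open>E\<close> and \<open>1 / L (u v)\<close>. The
  quotient yields the term with \<open>A\<close>, the other two the term with
  \<open>C\<close>.\<close>

lemma Phi_density_close:
  assumes "v \<in> {\<alpha>..\<xi>}"
  shows "\<bar>chi_density u v * inner_integral u v - chi_density w v * inner_integral w v\<bar>
    \<le> Phi_majorant v * M"
proof -
  have v: "v > 0" "v \<ge> \<alpha>" "v \<le> \<xi>" using assms \<alpha>_pos by auto
  define A where "A = K_M / L_m * a\<^sup>2 * D"
  define C where "C = K_M * Lt / L_m\<^sup>2 + Kt / L_m"
  let ?h = "\<lambda>u s. K (u s) * (E v u / E s u) / L (u v) / (v\<^sup>2 * s\<^sup>2)"
  let ?b = "\<lambda>s. (A * (v\<^sup>2 - s\<^sup>2) + C) * M / (v\<^sup>2 * s\<^sup>2)"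
  let ?B = "\<lambda>s. M / v\<^sup>2 * (- (A * v\<^sup>2 + C) / s - A * s)"
  have 1: "(?b has_integral (?B v - ?B \<alpha>)) {\<alpha>..v}"
  proof (rule fundamental_theorem_of_calculus[OF v(2)])
    fix s assume "s \<in> {\<alpha>..v}"
    then have s: "s > 0" using \<alpha>_pos by auto
    have "(?B has_real_derivative ?b s) (at s within {\<alpha>..v})"
      using s v by (auto intro!: derivative_eq_intros simp: field_simps power2_eq_square)
    then show "(?B has_vector_derivative ?b s) (at s within {\<alpha>..v})"
      by (simp add: has_real_derivative_iff_has_vector_derivative)
  qed
  have int: "?h u integrable_on {\<alpha>..v}" "?h w integrable_on {\<alpha>..v}"
    using density_integrable[OF u_cont v(3)] density_integrable[OF w_cont v(3)] by simp_all
  have "\<bar>integral {\<alpha>..v} (?h u) - integral {\<alpha>..v} (?h w)\<bar>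
      = norm (integral {\<alpha>..v} (\<lambda>s. ?h u s - ?h w s))"
    using integral_diff[OF int] by simp
  also have "\<dots> \<le> integral {\<alpha>..v} ?b"
  proof (rule integral_norm_bound_integral)
    fix s assume "s \<in> {\<alpha>..v}"
    then have s: "\<alpha> \<le> s" "s \<le> v" "s > 0" using \<alpha>_pos by auto
    let ?G = "\<lambda>u. E v u / E s u"
    have G: "0 \<le> ?G u" "0 \<le> ?G w" "?G u \<le> 1" "?G w \<le> 1"
      using E_quotient_le_1[OF u_cont s(1,2) v(3)] E_quotient_le_1[OF w_cont s(1,2) v(3)]
      by (auto simp: less_imp_le E_pos)
    \<comment> \<open>The variation of the quotient meets the bound \<open>K_M\<close>, that of
      \<open>K\<close> meets the bound 1 on the quotient.\<close>
    have KG: "\<bar>K (u s) * ?G u - K (w s) * ?G w\<bar> \<le> K_M * \<bar>?G u - ?G w\<bar> + 1 * \<bar>K (u s) - K (w s)\<bar>"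
      using K_bounds G by (intro abs_diff_mult_le) auto
    also have "\<dots> \<le> K_M * (a\<^sup>2 * D * (v\<^sup>2 - s\<^sup>2) * M) + 1 * (Kt * M)"
      using s v K_M_nonneg coefficients_close(3)[of s] E_quotient_close[OF s(1,2) v(3)]
      by (intro add_mono mult_left_mono) auto
    finally have KG: "\<bar>K (u s) * ?G u - K (w s) * ?G w\<bar> \<le> K_M * (a\<^sup>2 * D * (v\<^sup>2 - s\<^sup>2) * M) + Kt * M"
      by simp
    have "K (w s) * ?G w \<le> K_M * 1"
      using K_bounds G K_M_nonneg by (intro mult_mono) auto
    moreover have "0 \<le> K (w s) * ?G w"
      using K_bounds G by (intro mult_nonneg_nonneg) auto
    ultimately have "\<bar>K (w s) * ?G w\<bar> \<le> K_M" by simp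
    then have "\<bar>K (u s) * ?G u / L (u v) - K (w s) * ?G w / L (w v)\<bar>
        \<le> \<bar>K (u s) * ?G u - K (w s) * ?G w\<bar> / L_m + K_M * \<bar>L (u v) - L (w v)\<bar> / L_m\<^sup>2"
      using L_m_pos L_lower by (intro abs_diff_quotient_le)
    also have "\<dots> \<le> (K_M * (a\<^sup>2 * D * (v\<^sup>2 - s\<^sup>2) * M) + Kt * M) / L_m + K_M * (Lt * M) / L_m\<^sup>2"
      using KG coefficients_close(1)[OF assms] L_m_pos K_M_nonneg
      by (intro add_mono divide_right_mono mult_left_mono) auto
    also have "\<dots> = (A * (v\<^sup>2 - s\<^sup>2) + C) * M"
      using L_m_pos by (simp add: A_def C_def field_simps power2_eq_square)
    finally have "\<bar>K (u s) * ?G u / L (u v) - K (w s) * ?G w / L (w v)\<bar> / (v\<^sup>2 * s\<^sup>2) \<le> ?b s"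
      by (intro divide_right_mono) auto
    then show "norm (?h u s - ?h w s) \<le> ?b s"
      unfolding diff_divide_distrib[symmetric] by simp
  qed (use int 1 in \<open>auto intro: integrable_diff simp del: times_divide_eq_right\<close>)
  also have "\<dots> = ?B v - ?B \<alpha>" using 1 by (rule integral_unique)
  also have "\<dots> = Phi_majorant v * M"
    using v \<alpha>_pos unfolding Phi_majorant_def A_def[symmetric] C_def[symmetric]
    by (simp add: field_simps power2_eq_square)
  finally show ?thesis
    unfolding chi_density_mult_inner_integral[OF u_cont v(3)]
      chi_density_mult_inner_integral[OF w_cont v(3)] .
qed

end

section \<open>Antiderivatives of the majorants and their comparison with
  \<open>eps1\<close>\<close>

lemma chi1_tilde_deriv:
  assumes "z > 0"
  shows "((\<lambda>z. chi1_tilde a L_m N_M Lt Nt z \<alpha>) has_real_derivative chi_majorant z) (at z within S)"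
  unfolding chi1_tilde_def chi_majorant_def using assms L_m_pos
  by (auto intro!: derivative_eq_intros simp: field_simps power2_eq_square)

lemma chi1_tilde_self: "chi1_tilde a L_m N_M Lt Nt \<alpha> \<alpha> = 0"
  using \<alpha>_pos by (simp add: chi1_tilde_def power2_eq_square)

text \<open>The first summand of \<open>chi_majorant\<close> vanishes at \<alpha>; the positive
  second one makes the growth strict from the start.\<close>

lemma chi1_tilde_strict_mono:
  assumes "\<alpha> \<le> y" "y < z"
  shows "chi1_tilde a L_m N_M Lt Nt y \<alpha> < chi1_tilde a L_m N_M Lt Nt z \<alpha>"
proof (rule DERIV_pos_imp_increasing[OF assms(2)])
  fix x assume x: "y \<le> x" "x \<le> z"
  then have "x > 0" "\<alpha>\<^sup>2 / x\<^sup>2 \<le> 1"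
    using assms \<alpha>_pos by (auto intro: power_mono)
  then have "chi_majorant x > 0"
    unfolding chi_majorant_def using L_m_pos D_pos Lt_pos
    by (intro add_nonneg_pos mult_nonneg_nonneg) auto
  then show "\<exists>d. ((\<lambda>z. chi1_tilde a L_m N_M Lt Nt z \<alpha>) has_real_derivative d) (at x) \<and> d > 0"
    using chi1_tilde_deriv \<open>x > 0\<close> by blast
qed

text \<open>Dropping nonnegative terms leaves linear growth with positive slope, which forces
  \<open>eps1\<close> to reach 1.\<close>

lemma chi1_tilde_ge:
  assumes "z \<ge> \<alpha>"
  shows "a\<^sup>2 / L_m * D * (z - 2 * \<alpha>) \<le> chi1_tilde a L_m N_M Lt Nt z \<alpha>"
proof -
  have "a\<^sup>2 / L_m * D * (z - 2 * \<alpha>) \<le> a\<^sup>2 / L_m * D * (z + \<alpha>\<^sup>2 / z - 2 * \<alpha>)"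
    using D_pos L_m_pos assms \<alpha>_pos by (intro mult_left_mono) auto
  moreover have "0 \<le> Lt / L_m\<^sup>2 * (1 / \<alpha> - 1 / z)"
    using Lt_pos assms \<alpha>_pos by (simp add: frac_le)
  ultimately show ?thesis unfolding chi1_tilde_def by linarith
qed

text \<open>The bracket difference equals \<open>z/\<alpha> - 2 ln (z/\<alpha>) - \<alpha>/z\<close>. The exponential factors of
  \<open>Phi1_tilde\<close> are absent because \<open>E v u\<close> and \<open>1 / E s u\<close> enter only through their quotient,
  which is at most \<open>1\<close> for \<open>s \<le> v\<close>.\<close>

definition antiderivative_majorant :: "real \<Rightarrow> real \<Rightarrow> real" where
  "antiderivative_majorant P z = \<alpha>\<^sup>2 * P * chi1_tilde a L_m N_M Lt Nt z \<alpha> +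
    k\<^sup>2 / (16 * a\<^sup>2 * pi\<^sup>2) *
      (K_M / L_m * a\<^sup>2 * D * (Phi_bracket1 \<alpha> z - Phi_bracket3 \<alpha> z)
       + (K_M * Lt / L_m\<^sup>2 + Kt / L_m) * Phi_bracket2 \<alpha> z)"

lemma antiderivative_majorant_deriv:
  assumes "z > 0"
  shows "(antiderivative_majorant P has_real_derivative
     \<alpha>\<^sup>2 * P * chi_majorant z + k\<^sup>2 / (16 * a\<^sup>2 * pi\<^sup>2) * Phi_majorant z) (at z within S)"
proof -
  \<comment> \<open>The difference of the derivatives of the first and third brackets collapses to
    \<open>(1 - \<alpha> / z)\<^sup>2 / \<alpha>\<close>, the factor of \<open>A\<close> in
    \<open>Phi_majorant\<close>.\<close>
  have "((1 - \<alpha> / z)\<^sup>2 * (1 + \<alpha> / z) / \<alpha> - (1 - \<alpha> / z)\<^sup>2 / z) = 1 / \<alpha> - 2 / z + \<alpha> / z\<^sup>2"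
    using assms \<alpha>_pos by (simp add: field_simps power2_eq_square)
  then have *: "Phi_majorant z = K_M / L_m * a\<^sup>2 * D *
      ((1 - \<alpha> / z)\<^sup>2 * (1 + \<alpha> / z) / \<alpha> - (1 - \<alpha> / z)\<^sup>2 / z) +
      (K_M * Lt / L_m\<^sup>2 + Kt / L_m) * ((1 / \<alpha> - 1 / z) / z\<^sup>2)"
    by (simp add: Phi_majorant_def)
  show ?thesis
    unfolding antiderivative_majorant_def[abs_def] *
    by (intro DERIV_add DERIV_cmult DERIV_diff chi1_tilde_deriv Phi_bracket_deriv \<alpha>_pos assms)
qed

lemma antiderivative_majorant_self: "antiderivative_majorant P \<alpha> = 0"
  using \<alpha>_pos by (simp add: antiderivative_majorant_def Phi_bracket_self chi1_tilde_self)

text \<open>Compared with the majorant, \<open>eps1\<close> doubles the \<open>chi1_tilde\<close>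
  term, multiplies the first two brackets by exponentials that are at least 1, and adds a
  nonnegative multiple of the third bracket instead of subtracting one.\<close>

lemma antiderivative_majorant_le_eps1:
  assumes "\<alpha> \<le> z" "P > 0" "N_m \<ge> 0" "L_M > 0"
  shows "antiderivative_majorant P z \<le> eps1 a k P L_m L_M N_m N_M K_M Lt Nt Kt \<alpha> z"
proof -
  let ?A = "K_M / L_m * a\<^sup>2 * D" and ?C = "K_M * Lt / L_m\<^sup>2 + Kt / L_m"
  let ?g = "exp (a\<^sup>2 * (N_m / L_M) * (z\<^sup>2 - \<alpha>\<^sup>2))" and ?e = "exp (a\<^sup>2 * (N_M / L_m) * (z\<^sup>2 - \<alpha>\<^sup>2))"
  have A: "?A \<ge> 0" and C: "?C \<ge> 0"
    using K_M_nonneg L_m_pos D_pos Lt_pos Kt_pos by auto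
  have B: "Phi_bracket1 \<alpha> z \<ge> 0" "Phi_bracket2 \<alpha> z \<ge> 0" "Phi_bracket3 \<alpha> z \<ge> 0"
    using Phi_bracket_nonneg[OF \<alpha>_pos assms(1)] by auto
  have "z\<^sup>2 \<ge> \<alpha>\<^sup>2" using assms(1) \<alpha>_pos by (intro power_mono) auto
  then have ge: "?g \<ge> 1" "?e \<ge> 1"
    using assms N_M_nonneg L_m_pos by auto
  have "?A * (Phi_bracket1 \<alpha> z - Phi_bracket3 \<alpha> z) \<le> ?A * (1 * Phi_bracket1 \<alpha> z)"
    using A B by (intro mult_left_mono) auto
  also have "\<dots> \<le> ?A * (?g * Phi_bracket1 \<alpha> z)"
    using A B ge by (intro mult_left_mono mult_right_mono) auto
  finally have 1: "?A * (Phi_bracket1 \<alpha> z - Phi_bracket3 \<alpha> z) \<le> ?A * ?g * Phi_bracket1 \<alpha> z"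
    by (simp only: mult.assoc)
  have 2: "?C * (1 * Phi_bracket2 \<alpha> z) \<le> ?C * (?e * Phi_bracket2 \<alpha> z)"
    using C B ge by (intro mult_left_mono mult_right_mono) auto
  have 3: "0 \<le> ?A * ?e\<^sup>2 * Phi_bracket3 \<alpha> z"
    by (intro mult_nonneg_nonneg[OF mult_nonneg_nonneg[OF A zero_le_power2] B(3)])
  have "chi1_tilde a L_m N_M Lt Nt z \<alpha> \<ge> 0"
    using chi1_tilde_strict_mono[of \<alpha> z] chi1_tilde_self assms(1) by (cases "\<alpha> = z") auto
  then have 4: "\<alpha>\<^sup>2 * P * chi1_tilde a L_m N_M Lt Nt z \<alpha> \<le> 2 * \<alpha>\<^sup>2 * P * chi1_tilde a L_m N_M Lt Nt z \<alpha>"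
    using assms(2) by (intro mult_right_mono) auto
  show ?thesis
    unfolding antiderivative_majorant_def eps1_def Phi1_tilde_eq_brackets
    using 1 2 3 by (intro add_mono[OF 4] mult_left_mono) (simp_all add: mult.assoc)
qed

section \<open>Monotonicity of \<open>eps1\<close> and its crossing of the value 1\<close>

text \<open>The \<open>Phi1_tilde\<close> part is a sum of products of nonnegative nondecreasing
  factors; strictness comes from the \<open>chi1_tilde\<close> part.\<close>

lemma eps1_strict_mono:
  assumes "\<alpha> \<le> y" "y < z" "P > 0" "N_m \<ge> 0" "L_M > 0"
  shows "eps1 a k P L_m L_M N_m N_M K_M Lt Nt Kt \<alpha> y < eps1 a k P L_m L_M N_m N_M K_M Lt Nt Kt \<alpha> z"
proof -
  have "y\<^sup>2 \<le> z\<^sup>2" using assms \<alpha>_pos by (intro power_mono) auto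
  then have exp_mono: "exp (a\<^sup>2 * (N_m / L_M) * (y\<^sup>2 - \<alpha>\<^sup>2)) \<le> exp (a\<^sup>2 * (N_m / L_M) * (z\<^sup>2 - \<alpha>\<^sup>2))"
    "exp (a\<^sup>2 * (N_M / L_m) * (y\<^sup>2 - \<alpha>\<^sup>2)) \<le> exp (a\<^sup>2 * (N_M / L_m) * (z\<^sup>2 - \<alpha>\<^sup>2))"
    using assms N_M_nonneg L_m_pos by (auto intro!: mult_left_mono divide_right_mono)
  have A: "K_M / L_m * a\<^sup>2 * D \<ge> 0" and C: "K_M * Lt / L_m\<^sup>2 + Kt / L_m \<ge> 0"
    using K_M_nonneg L_m_pos D_pos Lt_pos Kt_pos by auto
  have "Phi1_tilde a k L_m L_M N_m N_M K_M Lt Nt Kt y \<alpha> \<le> Phi1_tilde a k L_m L_M N_m N_M K_M Lt Nt Kt z \<alpha>"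
    unfolding Phi1_tilde_eq_brackets
    using exp_mono assms Phi_bracket_mono[OF \<alpha>_pos assms(1), of z] Phi_bracket_nonneg[OF \<alpha>_pos assms(1)]
      A C
    by (intro mult_left_mono add_mono mult_mono power_mono) (auto simp del: times_divide_eq_left)
  moreover have "2 * \<alpha>\<^sup>2 * P * chi1_tilde a L_m N_M Lt Nt y \<alpha> < 2 * \<alpha>\<^sup>2 * P * chi1_tilde a L_m N_M Lt Nt z \<alpha>"
    using \<alpha>_pos assms by (intro mult_strict_left_mono chi1_tilde_strict_mono) auto
  ultimately show ?thesis unfolding eps1_def by linarith
qed

lemma eps1_self: "eps1 a k P L_m L_M N_m N_M K_M Lt Nt Kt \<alpha> \<alpha> = 0"
  using \<alpha>_pos unfolding eps1_def Phi1_tilde_eq_brackets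
  by (simp add: chi1_tilde_self Phi_bracket_self)

lemma eps1_continuous:
  "continuous_on {\<alpha>..} (\<lambda>z. eps1 a k P L_m L_M N_m N_M K_M Lt Nt Kt \<alpha> z)"
proof -
  have pos: "z > 0" if "z \<in> {\<alpha>..}" for z using that \<alpha>_pos by auto
  note cont = DERIV_continuous_on[OF chi1_tilde_deriv[OF pos]]
    DERIV_continuous_on[OF Phi_bracket_deriv(1)[OF \<alpha>_pos pos]]
    DERIV_continuous_on[OF Phi_bracket_deriv(2)[OF \<alpha>_pos pos]]
    DERIV_continuous_on[OF Phi_bracket_deriv(3)[OF \<alpha>_pos pos]]
  show ?thesis
    unfolding eps1_def Phi1_tilde_eq_brackets
    by (intro continuous_on_add continuous_on_mult continuous_on_power continuous_on_exp
        continuous_on_diff continuous_on_const continuous_on_id cont)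
qed

lemma eps1_attains_1:
  assumes "P > 0" "N_m \<ge> 0" "L_M > 0"
  shows "\<exists>z>\<alpha>. eps1 a k P L_m L_M N_m N_M K_M Lt Nt Kt \<alpha> z = 1"
proof -
  let ?eps = "eps1 a k P L_m L_M N_m N_M K_M Lt Nt Kt \<alpha>"
  define \<kappa> where "\<kappa> = 2 * \<alpha>\<^sup>2 * P * (a\<^sup>2 / L_m * D)"
  \<comment> \<open>Here the linear lower bound \<open>\<kappa> * (b - 2 * \<alpha>)\<close> of
    \<open>eps1\<close> equals 1, so the intermediate value theorem applies on
    [\<alpha>, b].\<close>
  define b where "b = 2 * \<alpha> + 1 / \<kappa>"
  have \<kappa>: "\<kappa> > 0"
    unfolding \<kappa>_def using \<alpha>_pos a_pos L_m_pos D_pos assms(1) by simp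
  then have b: "b > \<alpha>" unfolding b_def using \<alpha>_pos by (simp add: add_pos_pos)
  have "1 = \<kappa> * (b - 2 * \<alpha>)"
    using \<kappa> by (simp add: b_def)
  also have "\<dots> = 2 * \<alpha>\<^sup>2 * P * (a\<^sup>2 / L_m * D * (b - 2 * \<alpha>))"
    unfolding \<kappa>_def by (simp only: mult.assoc)
  also have "\<dots> \<le> 2 * \<alpha>\<^sup>2 * P * chi1_tilde a L_m N_M Lt Nt b \<alpha>"
    using assms(1) b by (intro mult_left_mono chi1_tilde_ge) auto
  also have "\<dots> \<le> ?eps b"
    unfolding eps1_def Phi1_tilde_eq_brackets
    using Phi_bracket_nonneg[OF \<alpha>_pos, of b] b K_M_nonneg L_m_pos D_pos Lt_pos Kt_pos
    by (simp add: less_imp_le)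
  finally have "1 \<le> ?eps b" .
  then obtain z where "\<alpha> \<le> z" "?eps z = 1"
    using IVT'[of ?eps \<alpha> 1 b] b eps1_self continuous_on_subset[OF eps1_continuous]
    by (metis atLeastAtMost_iff atLeast_iff less_imp_le subsetI zero_le_one)
  moreover have "z \<noteq> \<alpha>" using \<open>?eps z = 1\<close> eps1_self by auto
  ultimately show ?thesis by (intro exI[of _ z]) auto
qed

section \<open>Contraction property of the right-hand side\<close>

definition solution_density :: "real \<Rightarrow> (real \<Rightarrow> real) \<Rightarrow> real \<Rightarrow> real" where
  "solution_density P u v = \<alpha>\<^sup>2 * P * chi_density u v +
     k\<^sup>2 / (16 * a\<^sup>2 * pi\<^sup>2) * (chi_density u v * inner_integral u v)"

lemma solution_density_continuous:
  assumes "continuous_on {\<alpha>..\<xi>} u"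
  shows "continuous_on {\<alpha>..\<xi>} (solution_density P u)"
  unfolding solution_density_def
  by (intro continuous_intros chi_density_continuous inner_integral_continuous assms)

lemma solution_density_integral:
  assumes "continuous_on {\<alpha>..\<xi>} u" "\<eta> \<in> {\<alpha>..\<xi>}"
  shows "\<alpha>\<^sup>2 * P * (chi1 a L N \<xi> u \<alpha> - chi1 a L N \<eta> u \<alpha>) + Phi1 a k L N K \<xi> u \<alpha> - Phi1 a k L N K \<eta> u \<alpha>
    = integral {\<eta>..\<xi>} (solution_density P u)"
proof -
  have cont: "continuous_on {\<alpha>..\<xi>} (chi_density u)"
    "continuous_on {\<alpha>..\<xi>} (\<lambda>v. chi_density u v * inner_integral u v)"
    by (intro continuous_intros chi_density_continuous inner_integral_continuous assms)+
  have eq: "integral {\<alpha>..\<xi>} f - integral {\<alpha>..\<eta>} f = integral {\<eta>..\<xi>} f" and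
    int: "f integrable_on {\<eta>..\<xi>}" if "continuous_on {\<alpha>..\<xi>} f" for f :: "real \<Rightarrow> real"
    using assms(2) that
    by (auto intro!: integral_diff_lower integrable_continuous_real intro: continuous_on_subset)
  have "integral {\<eta>..\<xi>} (solution_density P u) = \<alpha>\<^sup>2 * P * integral {\<eta>..\<xi>} (chi_density u)
      + k\<^sup>2 / (16 * a\<^sup>2 * pi\<^sup>2) * integral {\<eta>..\<xi>} (\<lambda>v. chi_density u v * inner_integral u v)"
    unfolding solution_density_def
    by (subst integral_add)
      (intro integrable_on_mult_right int cont | simp only: integral_mult_right)+
  then show ?thesis
    unfolding eq[OF cont(1), symmetric] eq[OF cont(2), symmetric]
    by (simp add: chi1_def Phi1_def chi_density_def[abs_def] inner_integral_def algebra_simps)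
qed

lemma solution_density_integral_close:
  assumes u: "continuous_on {\<alpha>..\<xi>} u" and w: "continuous_on {\<alpha>..\<xi>} w"
    and close: "\<And>t. t \<in> {\<alpha>..\<xi>} \<Longrightarrow> \<bar>u t - w t\<bar> \<le> M"
    and \<eta>: "\<eta> \<in> {\<alpha>..\<xi>}" and P: "P > 0"
  shows "\<bar>integral {\<eta>..\<xi>} (solution_density P u) - integral {\<eta>..\<xi>} (solution_density P w)\<bar>
    \<le> antiderivative_majorant P \<xi> * M"
proof -
  define c where "c = k\<^sup>2 / (16 * a\<^sup>2 * pi\<^sup>2)"
  have c: "c \<ge> 0" by (simp add: c_def)
  let ?b = "\<lambda>v. (\<alpha>\<^sup>2 * P * chi_majorant v + c * Phi_majorant v) * M"
  let ?d = "\<lambda>v. solution_density P u v - solution_density P w v"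
  have int: "(?b has_integral (antiderivative_majorant P \<xi> * M - antiderivative_majorant P \<alpha> * M)) {\<alpha>..\<xi>}"
  proof (rule fundamental_theorem_of_calculus)
    fix x assume "x \<in> {\<alpha>..\<xi>}"
    then show "((\<lambda>v. antiderivative_majorant P v * M) has_vector_derivative ?b x) (at x within {\<alpha>..\<xi>})"
      using \<alpha>_pos antiderivative_majorant_deriv[of x P "{\<alpha>..\<xi>}"]
      unfolding has_real_derivative_iff_has_vector_derivative[symmetric] c_def[symmetric]
      by (intro DERIV_cmult_right) auto
  qed (use \<eta> in auto)
  have b: "\<bar>?d v\<bar> \<le> ?b v" if v: "v \<in> {\<alpha>..\<xi>}" for v
  proof -
    have "?d v = \<alpha>\<^sup>2 * P * (chi_density u v - chi_density w v) +
        c * (chi_density u v * inner_integral u v - chi_density w v * inner_integral w v)"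
      unfolding solution_density_def c_def[symmetric] by (simp add: algebra_simps)
    then have "\<bar>?d v\<bar> \<le> \<bar>\<alpha>\<^sup>2 * P * (chi_density u v - chi_density w v)\<bar> +
        \<bar>c * (chi_density u v * inner_integral u v - chi_density w v * inner_integral w v)\<bar>"
      by (simp only: abs_triangle_ineq)
    also have "\<dots> = \<alpha>\<^sup>2 * P * \<bar>chi_density u v - chi_density w v\<bar> +
        c * \<bar>chi_density u v * inner_integral u v - chi_density w v * inner_integral w v\<bar>"
      by (simp only: abs_mult abs_power2 abs_of_pos[OF P] abs_of_nonneg[OF c])
    also have "\<dots> \<le> \<alpha>\<^sup>2 * P * (chi_majorant v * M) + c * (Phi_majorant v * M)"
      using P c chi_density_close[OF u w close v] Phi_density_close[OF u w close v]
      by (intro add_mono mult_left_mono) auto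
    finally show ?thesis by (simp add: algebra_simps)
  qed
  have cont: "continuous_on {\<alpha>..\<xi>} (solution_density P u)" "continuous_on {\<alpha>..\<xi>} (solution_density P w)"
    using u w by (auto intro: solution_density_continuous)
  have ints: "f integrable_on {\<eta>..\<xi>}" if "f integrable_on {\<alpha>..\<xi>}" for f :: "real \<Rightarrow> real"
    using \<eta> by (intro integrable_on_subinterval[OF that]) auto
  have "\<bar>integral {\<eta>..\<xi>} (solution_density P u) - integral {\<eta>..\<xi>} (solution_density P w)\<bar>
     = norm (integral {\<eta>..\<xi>} ?d)"
    by (subst integral_diff) (intro ints integrable_continuous_real cont | simp)+
  also have "\<dots> \<le> integral {\<eta>..\<xi>} ?b"
  proof (rule integral_norm_bound_integral)
    show "?d integrable_on {\<eta>..\<xi>}"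
      by (intro integrable_diff ints integrable_continuous_real cont)
    show "?b integrable_on {\<eta>..\<xi>}"
      using int by (intro ints) (rule has_integral_integrable)
    show "norm (?d x) \<le> ?b x" if "x \<in> {\<eta>..\<xi>}" for x
      using b[of x] that \<eta> by simp
  qed
  \<comment> \<open>The majorant dominates an absolute value, hence is nonnegative; enlarging the
    interval makes the bound independent of \<eta>.\<close>
  also have "\<dots> \<le> integral {\<alpha>..\<xi>} ?b"
  proof (rule integral_subset_le)
    show "\<forall>x\<in>{\<alpha>..\<xi>}. 0 \<le> ?b x"
      using b abs_ge_zero order_trans by blast
    show "?b integrable_on {\<alpha>..\<xi>}" using int by (rule has_integral_integrable)
    then show "?b integrable_on {\<eta>..\<xi>}" by (rule ints)
  qed (use \<eta> in auto)
  also have "\<dots> = antiderivative_majorant P \<xi> * M"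
    using integral_unique[OF int] antiderivative_majorant_self by simp
  finally show ?thesis .
qed

lemma integral_equation_unique_solution:
  assumes "\<alpha> < \<xi>" "P > 0" "N_m \<ge> 0" "L_M > 0"
    and "eps1 a k P L_m L_M N_m N_M K_M Lt Nt Kt \<alpha> \<xi> < 1"
  shows "\<exists>!u. u \<in> C0 {\<alpha>..\<xi>} \<and> (\<forall>\<eta>\<in>{\<alpha>..\<xi>}. u \<eta> =
      \<alpha>\<^sup>2 * P * (chi1 a L N \<xi> u \<alpha> - chi1 a L N \<eta> u \<alpha>) + Phi1 a k L N K \<xi> u \<alpha> - Phi1 a k L N K \<eta> u \<alpha>)"
proof (rule unique_fixed_point_on_interval)
  let ?T = "\<lambda>u \<eta>. \<alpha>\<^sup>2 * P * (chi1 a L N \<xi> u \<alpha> - chi1 a L N \<eta> u \<alpha>) + Phi1 a k L N K \<xi> u \<alpha> - Phi1 a k L N K \<eta> u \<alpha>"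
  let ?c = "eps1 a k P L_m L_M N_m N_M K_M Lt Nt Kt \<alpha> \<xi>"
  show "0 \<le> ?c"
    using eps1_strict_mono[of \<alpha> \<xi> P N_m L_M] eps1_self assms by simp
  show "continuous_on {\<alpha>..\<xi>} (?T u)" if u: "continuous_on {\<alpha>..\<xi>} u" for u
  proof -
    have "continuous_on {\<alpha>..\<xi>} (\<lambda>\<eta>. integral {\<eta>..\<xi>} (solution_density P u))"
      by (intro indefinite_integral_continuous_1' integrable_continuous_real
          solution_density_continuous u)
    then show ?thesis
      using continuous_on_cong[of "{\<alpha>..\<xi>}" "{\<alpha>..\<xi>}" "?T u"] solution_density_integral[OF u]
      by simp
  qed
  show "\<bar>?T u \<eta> - ?T w \<eta>\<bar> \<le> ?c * M"
    if u: "continuous_on {\<alpha>..\<xi>} u" and w: "continuous_on {\<alpha>..\<xi>} w"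
      and close: "\<And>t. t \<in> {\<alpha>..\<xi>} \<Longrightarrow> \<bar>u t - w t\<bar> \<le> M" and \<eta>: "\<eta> \<in> {\<alpha>..\<xi>}" for u w M \<eta>
  proof -
    \<comment> \<open>This sign is what allows the majorant to be replaced by the larger constant
      \<open>eps1\<close>.\<close>
    have "M \<ge> 0" using close[OF \<eta>] by linarith
    have "\<bar>?T u \<eta> - ?T w \<eta>\<bar> \<le> antiderivative_majorant P \<xi> * M"
      unfolding solution_density_integral[OF u \<eta>] solution_density_integral[OF w \<eta>]
      using u w close \<eta> assms(2) by (rule solution_density_integral_close)
    also have "\<dots> \<le> ?c * M"
      using assms \<open>M \<ge> 0\<close> by (intro mult_right_mono antiderivative_majorant_le_eps1) auto
    finally show ?thesis .
  qed
qed (use assms in auto)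

end

section \<open>Positivity of \<open>\<alpha>\<^sub>0\<close> and passage to the given
  hypotheses\<close>

text \<open>The square root is strictly increasing, so subtracting a positive amount from
  \<open>P\<^sup>2\<close> brings it below \<open>P\<close> and the denominator is positive.\<close>

lemma alpha0_pos:
  fixes a P lam_b L_b gam_b \<theta> \<alpha>\<^sub>0 :: real
  assumes "a > 0" "P > 0" "lam_b > 0" "L_b > 0" "gam_b > 0" "\<theta> > 0"
    and "\<alpha>\<^sub>0 = 2 * sqrt pi * lam_b * \<theta> / (P - sqrt (P\<^sup>2 - 8 * a\<^sup>2 * pi * L_b * gam_b * lam_b * \<theta>))"
  shows "\<alpha>\<^sub>0 > 0"
proof -
  have "sqrt (P\<^sup>2 - 8 * a\<^sup>2 * pi * L_b * gam_b * lam_b * \<theta>) < sqrt (P\<^sup>2)"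
    using assms by (intro real_sqrt_less_mono) simp
  also have "\<dots> = P" using assms by simp
  finally show ?thesis using assms by simp
qed

theorem theorem3p1:
  fixes a P lam_b L_b gam_b th_ion th_b k \<alpha>\<^sub>0 :: real
    and L1 N1 K1 L2 N2 K2 :: "real \<Rightarrow> real"
    and L_m L_M N_m N_M K_m K_M R Lt1 Lt2 Nt1 Nt2 Kt1 Kt2 :: real
  assumes "a > 0" "P > 0" "lam_b > 0" "L_b > 0" "gam_b > 0" "th_ion > th_b"
    and "P \<ge> 2 * a * sqrt (2 * pi) * sqrt (lam_b * L_b * gam_b * (th_ion - th_b))"
    and "\<alpha>\<^sub>0 = 2 * sqrt pi * lam_b * (th_ion - th_b) /
           (P - sqrt (P\<^sup>2 - 8 * a\<^sup>2 * pi * L_b * gam_b * lam_b * (th_ion - th_b)))"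
    and "\<And>x. K1 x \<ge> 0" "\<And>x. K2 x \<ge> 0"
    and "L_m > 0" "L_M > 0" "N_m > 0" "N_M > 0" "K_m > 0" "K_M > 0" "R > 0"
    and "Lt1 > 0" "Lt2 > 0" "Nt1 > 0" "Nt2 > 0" "Kt1 > 0" "Kt2 > 0"
    and "R \<ge> a\<^sup>2 * N_M / L_m"
    and "\<And>\<xi>. \<xi> > \<alpha>\<^sub>0 \<Longrightarrow> bounded_on_class (C0 {\<alpha>\<^sub>0..\<xi>}) {\<alpha>\<^sub>0..\<xi>} L1 L_m L_M"
    and "\<And>\<xi>. \<xi> > \<alpha>\<^sub>0 \<Longrightarrow> bounded_on_class (C0 {\<alpha>\<^sub>0..\<xi>}) {\<alpha>\<^sub>0..\<xi>} N1 N_m N_M"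
    and "\<And>\<xi>. \<xi> > \<alpha>\<^sub>0 \<Longrightarrow> bounded_on_class (C0 {\<alpha>\<^sub>0..\<xi>}) {\<alpha>\<^sub>0..\<xi>} K1 K_m K_M"
    and "\<And>\<xi>. \<xi> > \<alpha>\<^sub>0 \<Longrightarrow> lipschitz_on_class (C0 {\<alpha>\<^sub>0..\<xi>}) {\<alpha>\<^sub>0..\<xi>} L1 Lt1"
    and "\<And>\<xi>. \<xi> > \<alpha>\<^sub>0 \<Longrightarrow> lipschitz_on_class (C0 {\<alpha>\<^sub>0..\<xi>}) {\<alpha>\<^sub>0..\<xi>} N1 Nt1"
    and "\<And>\<xi>. \<xi> > \<alpha>\<^sub>0 \<Longrightarrow> lipschitz_on_class (C0 {\<alpha>\<^sub>0..\<xi>}) {\<alpha>\<^sub>0..\<xi>} K1 Kt1"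
    and "\<And>\<xi>. \<xi> > \<alpha>\<^sub>0 \<Longrightarrow> bounded_on_class (K_space \<xi>) {\<xi>..} L2 L_m L_M"
    and "\<And>\<xi>. \<xi> > \<alpha>\<^sub>0 \<Longrightarrow> bounded_on_class (K_space \<xi>) {\<xi>..} N2 N_m N_M"
    and "\<And>\<xi>. \<xi> > \<alpha>\<^sub>0 \<Longrightarrow> lipschitz_on_class (K_space \<xi>) {\<xi>..} L2 Lt2"
    and "\<And>\<xi>. \<xi> > \<alpha>\<^sub>0 \<Longrightarrow> lipschitz_on_class (K_space \<xi>) {\<xi>..} N2 Nt2"
    and "\<And>\<xi> u s. \<xi> > \<alpha>\<^sub>0 \<Longrightarrow> u \<in> K_space \<xi> \<Longrightarrow> s \<ge> \<xi> \<Longrightarrow>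
           K2 (u s) \<le> K_M * exp (- R * s\<^sup>2)"
    and "\<And>\<xi> u v s. \<xi> > \<alpha>\<^sub>0 \<Longrightarrow> u \<in> K_space \<xi> \<Longrightarrow> v \<in> K_space \<xi> \<Longrightarrow> s \<ge> \<xi> \<Longrightarrow>
           \<bar>K2 (u s) - K2 (v s)\<bar> \<le> Kt2 * exp (- R * s\<^sup>2) * supnorm {\<xi>..} (\<lambda>t. u t - v t)"
  shows "\<exists>\<xi>bar > \<alpha>\<^sub>0.
      eps1 a k P L_m L_M N_m N_M K_M Lt1 Nt1 Kt1 \<alpha>\<^sub>0 \<xi>bar = 1 \<and>
      (\<forall>z > \<alpha>\<^sub>0. eps1 a k P L_m L_M N_m N_M K_M Lt1 Nt1 Kt1 \<alpha>\<^sub>0 z = 1 \<longrightarrow> z = \<xi>bar) \<and>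
      (\<forall>\<xi>. \<alpha>\<^sub>0 < \<xi> \<and> \<xi> < \<xi>bar \<longrightarrow>
        (\<exists>!u. u \<in> C0 {\<alpha>\<^sub>0..\<xi>} \<and>
          (\<forall>\<eta>\<in>{\<alpha>\<^sub>0..\<xi>}.
             u \<eta> = \<alpha>\<^sub>0\<^sup>2 * P * (chi1 a L1 N1 \<xi> u \<alpha>\<^sub>0 - chi1 a L1 N1 \<eta> u \<alpha>\<^sub>0)
                   + Phi1 a k L1 N1 K1 \<xi> u \<alpha>\<^sub>0 - Phi1 a k L1 N1 K1 \<eta> u \<alpha>\<^sub>0)))"
proof -
  let ?eps = "eps1 a k P L_m L_M N_m N_M K_M Lt1 Nt1 Kt1 \<alpha>\<^sub>0"
  \<comment> \<open>The constants are independent of \<xi>, so a single interval, here of length 1,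
    gives the pointwise conditions for good.\<close>
  have gt: "\<alpha>\<^sub>0 < \<alpha>\<^sub>0 + 1" and ne: "{\<alpha>\<^sub>0..\<alpha>\<^sub>0 + 1} \<noteq> {}" by auto
  note bounds = bounded_on_class_C0D[OF assms(25)[OF gt] ne]
    bounded_on_class_C0D[OF assms(26)[OF gt] ne] bounded_on_class_C0D[OF assms(27)[OF gt] ne]
  note lipschitz = lipschitz_on_class_C0D[OF assms(28)[OF gt] ne]
    lipschitz_on_class_C0D[OF assms(29)[OF gt] ne] lipschitz_on_class_C0D[OF assms(30)[OF gt] ne]
  have "\<alpha>\<^sub>0 > 0"
    using alpha0_pos[of a P lam_b L_b gam_b "th_ion - th_b" \<alpha>\<^sub>0] assms(1-8) by simp
  then interpret coefficients a k \<alpha>\<^sub>0 L_m N_M K_M Lt1 Nt1 Kt1 L1 N1 K1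
    using assms(1-23) bounds lipschitz by unfold_locales (auto intro: order_trans less_imp_le)
  note params = \<open>P > 0\<close> less_imp_le[OF \<open>N_m > 0\<close>] \<open>L_M > 0\<close>
  obtain z where z: "z > \<alpha>\<^sub>0" "?eps z = 1"
    using eps1_attains_1[OF params] by blast
  have "\<forall>y>\<alpha>\<^sub>0. ?eps y = 1 \<longrightarrow> y = z"
    using eps1_strict_mono[OF _ _ params] z by (metis less_imp_le less_irrefl linorder_neqE)
  \<comment> \<open>Strict monotonicity turns lying left of the root into a contraction constant
    below 1.\<close>
  moreover have "?eps \<xi> < 1" if "\<alpha>\<^sub>0 < \<xi>" "\<xi> < z" for \<xi>
    using eps1_strict_mono[of \<xi> z, OF _ _ params] z that by simp
  ultimately show ?thesis
    using z integral_equation_unique_solution[OF _ params] by (intro exI[of _ z]) blast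
qed

end
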